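(* Let $G=(V,E)$ be a graph on $n$ vertices. Then for every $k\in\{0,\ldots,n-1\}$, $$p(G;n-k)=\big|\{S\subseteq V : |S|=k,\ S\cap N(V\setminus S)\text{ is a zero forcing set of } G[S]\}\big|.$$
   Context: Graphs are finite and simple. For $S\subseteq V$, color the vertices of $S$; then (domination step) every neighbor of a vertex of $S$ becomes colored; then repeatedly (forcing steps), whenever a colored vertex has exactly one uncolored neighbor, that neighbor becomes colored, until no more changes occur. $S$ is a power dominating set of $G$ if all vertices end up colored; $p(G;i)$ is the number of power dominating sets of $G$ of size $i$. A set $S$ is a zero forcing set of a graph $H$ if coloring $S$ and applying only the forcing rule (no domination step) repeatedly colors all vertices of $H$. For $T\subseteq V$, $N(T)=\left(\bigcup_{v\in T}N(v)\right)\setminus T$, where $N(v)$ is the set of neighbors of $v$. $G[S]$ is the subgraph induced by $S$. *)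

theory Defs
  imports "Graph_Theory.Digraph_Component"
begin

text \<open>
  A finite simple graph is a digraph satisfying the locale predicate \<^const>\<open>graph\<close>: finite,
  loop-free, without parallel arcs, and symmetric, so that each undirected edge is a pair of
  opposite arcs.
\<close>

definition neighbors :: "('a, 'b) pre_digraph \<Rightarrow> 'a \<Rightarrow> 'a set" where
  "neighbors G v = {u. v \<rightarrow>\<^bsub>G\<^esub> u}"

definition set_neighborhood :: "('a, 'b) pre_digraph \<Rightarrow> 'a set \<Rightarrow> 'a set" where
  "set_neighborhood G T = (\<Union>v\<in>T. neighbors G v) - T"

inductive force_step :: "('a, 'b) pre_digraph \<Rightarrow> 'a set \<Rightarrow> 'a set \<Rightarrow> bool"
  for G :: "('a, 'b) pre_digraph" where
  force: "u \<in> C \<Longrightarrow> neighbors G u - C = {w} \<Longrightarrow> force_step G C (insert w C)"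

definition domination_step :: "('a, 'b) pre_digraph \<Rightarrow> 'a set \<Rightarrow> 'a set" where
  "domination_step G S = S \<union> (\<Union>v\<in>S. neighbors G v)"

text \<open>
  Once all vertices are colored no forcing step applies, so reaching \<^term>\<open>verts G\<close> by forcing
  steps means that the process has terminated there. Forces never get disabled except by their
  target being colored, so the final coloring does not depend on the order of the steps.
\<close>

definition zero_forcing_set :: "('a, 'b) pre_digraph \<Rightarrow> 'a set \<Rightarrow> bool" where
  "zero_forcing_set G S \<longleftrightarrow> S \<subseteq> verts G \<and> (force_step G)\<^sup>*\<^sup>* S (verts G)"

definition power_dominating_set :: "('a, 'b) pre_digraph \<Rightarrow> 'a set \<Rightarrow> bool" where
  "power_dominating_set G S \<longleftrightarrow>
     S \<subseteq> verts G \<and> (force_step G)\<^sup>*\<^sup>* (domination_step G S) (verts G)"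

definition num_power_dominating_sets :: "('a, 'b) pre_digraph \<Rightarrow> nat \<Rightarrow> nat" where
  "num_power_dominating_sets G i = card {S. power_dominating_set G S \<and> card S = i}"

end

theory Submission
  imports Defs
begin

text \<open>
  Complementation is the bijection. Put \<open>A = V - S\<close>. After the domination step from \<open>A\<close> the
  colored vertices are \<open>A\<close> and \<open>S \<inter> N(A)\<close>, so no vertex of \<open>A\<close> has an uncolored neighbor and
  every force is made by a vertex of \<open>S\<close>. Such a vertex has the same uncolored neighbors in \<open>G\<close>
  as in \<open>G[S]\<close>, so from there the forcing processes in \<open>G\<close> and in \<open>G[S]\<close> are the same.
\<close>

lemma neighbors_subset_verts:
  assumes "wf_digraph G"
  shows "neighbors G u \<subseteq> verts G"
  using assms by (auto simp: neighbors_def dest: wf_digraph.adj_in_verts)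

lemma neighbors_induce_subgraph:
  assumes "u \<in> S"
  shows "neighbors (G \<restriction> S) u = neighbors G u \<inter> S"
  using assms by (auto simp: neighbors_def arcs_ends_def arc_to_ends_def)

text \<open>Adding the colored set \<open>verts G - S\<close> hides exactly those neighbors of a
  vertex of \<open>S\<close> that \<open>G \<restriction> S\<close> lacks, so each force in
  \<open>G \<restriction> S\<close> can be copied in \<open>G\<close>.
  \<open>D \<subseteq> S\<close> is carried along so that the next forcing vertex is known to lie in
  \<open>S\<close>.\<close>

lemma force_steps_extend_by_complement:
  assumes "wf_digraph G" "(force_step (G \<restriction> S))\<^sup>*\<^sup>* C D" "C \<subseteq> S"
  shows "(force_step G)\<^sup>*\<^sup>* (verts G - S \<union> C) (verts G - S \<union> D) \<and> D \<subseteq> S"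
  using assms(2)
proof (induction rule: rtranclp_induct)
  case base
  then show ?case using assms(3) by simp
next
  case (step D E)
  from step.hyps(2) obtain u w where u: "u \<in> D" "neighbors (G \<restriction> S) u - D = {w}"
    and E: "E = insert w D"
    by cases
  from u(1) step.IH have "u \<in> S" by blast
  then have nb: "neighbors G u \<inter> S - D = {w}"
    using u(2) by (simp add: neighbors_induce_subgraph)
  then have "neighbors G u - (verts G - S \<union> D) = {w}"
    using neighbors_subset_verts[OF assms(1), of u] by blast
  then have "force_step G (verts G - S \<union> D) (insert w (verts G - S \<union> D))"
    using u(1) by (intro force_step.force) auto
  moreover have "insert w (verts G - S \<union> D) = verts G - S \<union> E"
    by (simp add: E)
  moreover have "E \<subseteq> S" using nb E step.IH by blast
  ultimately show ?case using step.IH by (auto intro: rtranclp.rtrancl_into_rtrancl)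
qed

text \<open>The converse simulation. Once \<open>verts G - S\<close> and all its neighbors are
  colored, every force in \<open>G\<close> has source and target in \<open>S\<close>. Since
  colorings only grow, \<open>X \<subseteq> Y\<close> in the conclusion keeps this condition
  available throughout the induction.\<close>

lemma force_steps_restrict:
  assumes "wf_digraph G" "(force_step G)\<^sup>*\<^sup>* X Y"
    and "domination_step G (verts G - S) \<subseteq> X"
  shows "(force_step (G \<restriction> S))\<^sup>*\<^sup>* (X \<inter> S) (Y \<inter> S) \<and> X \<subseteq> Y"
  using assms(2)
proof (induction rule: rtranclp_induct)
  case base
  then show ?case by simp
next
  case (step Y Z)
  from step.hyps(2) obtain u w where u: "u \<in> Y" "neighbors G u - Y = {w}"
    and Z: "Z = insert w Y"
    by cases
  have dom: "verts G - S \<subseteq> Y" "\<And>v. v \<in> verts G - S \<Longrightarrow> neighbors G v \<subseteq> Y"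
    using assms(3) step.IH unfolding domination_step_def by blast+
  have "w \<in> neighbors G u" "w \<notin> Y" using u(2) by auto
  then have "u \<in> verts G" "w \<in> verts G"
    using assms(1) by (auto simp: neighbors_def dest: wf_digraph.adj_in_verts)
  \<comment> \<open>If \<open>u\<close> were outside \<open>S\<close>, its neighbor \<open>w\<close>
    would already be colored; if \<open>w\<close> were outside \<open>S\<close>, it would itself be
    in \<open>Y\<close>.\<close>
  then have S: "u \<in> S" "w \<in> S"
    using dom \<open>w \<in> neighbors G u\<close> \<open>w \<notin> Y\<close> by blast+
  then have "neighbors (G \<restriction> S) u - Y \<inter> S = {w}"
    using u(2) by (auto simp: neighbors_induce_subgraph)
  then have "force_step (G \<restriction> S) (Y \<inter> S) (insert w (Y \<inter> S))"
    using u(1) S by (intro force_step.force) auto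
  moreover have "insert w (Y \<inter> S) = Z \<inter> S" using Z S by auto
  ultimately show ?case using step.IH Z by (auto intro: rtranclp.rtrancl_into_rtrancl)
qed

lemma domination_step_complement:
  assumes "wf_digraph G" "S \<subseteq> verts G"
  shows "domination_step G (verts G - S) =
    verts G - S \<union> (S \<inter> set_neighborhood G (verts G - S))"
  using neighbors_subset_verts[OF assms(1)]
  unfolding domination_step_def set_neighborhood_def by blast

text \<open>The two simulations start from matching colorings by
  \<open>domination_step_complement\<close>, and \<open>verts G\<close> corresponds to
  \<open>S\<close>, the full vertex set of \<open>G \<restriction> S\<close>.\<close>

lemma power_dominating_set_complement_iff:
  assumes "wf_digraph G" "S \<subseteq> verts G"
  shows "power_dominating_set G (verts G - S) \<longleftrightarrow>
    zero_forcing_set (G \<restriction> S) (S \<inter> set_neighborhood G (verts G - S))"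
    (is "?P \<longleftrightarrow> ?Z")
proof
  assume ?P
  then have "(force_step (G \<restriction> S))\<^sup>*\<^sup>* (domination_step G (verts G - S) \<inter> S) (verts G \<inter> S)"
    unfolding power_dominating_set_def using force_steps_restrict[OF assms(1)] by blast
  moreover have "domination_step G (verts G - S) \<inter> S = S \<inter> set_neighborhood G (verts G - S)"
    unfolding domination_step_complement[OF assms] by blast
  moreover have "verts G \<inter> S = S" using assms(2) by blast
  ultimately show ?Z by (simp add: zero_forcing_set_def)
next
  assume ?Z
  then have "(force_step G)\<^sup>*\<^sup>* (domination_step G (verts G - S)) (verts G - S \<union> S)"
    unfolding zero_forcing_set_def domination_step_complement[OF assms]
    \<comment> \<open>Deleting \<open>Un_Diff_cancel2\<close> preserves the form
      \<open>verts G - S \<union> S\<close>.\<close>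
    using force_steps_extend_by_complement[OF assms(1), of S _ S] by (simp del: Un_Diff_cancel2)
  moreover have "verts G - S \<union> S = verts G" using assms(2) by blast
  ultimately show ?P by (simp add: power_dominating_set_def)
qed

theorem theorem6:
  fixes G :: "('a, 'b) pre_digraph" and n k :: nat
  assumes "graph G"
    and "card (verts G) = n"
    and "k < n"
  shows "num_power_dominating_sets G (n - k) =
    card {S. S \<subseteq> verts G \<and> card S = k \<and>
             zero_forcing_set (G \<restriction> S) (S \<inter> set_neighborhood G (verts G - S))}"
proof -
  interpret graph G by fact
  have wf: "wf_digraph G" ..
  have iff: "zero_forcing_set (G \<restriction> S) (S \<inter> set_neighborhood G (verts G - S)) \<longleftrightarrow>
      power_dominating_set G (verts G - S)" if "S \<subseteq> verts G" for S
    using power_dominating_set_complement_iff[OF wf that] by simp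
  have card_compl: "card (verts G - S) = n - card S" "card S \<le> n" if "S \<subseteq> verts G" for S
    using that assms(2) by (auto simp: card_Diff_subset finite_subset intro: card_mono)
  have "bij_betw (\<lambda>S. verts G - S) {S. power_dominating_set G S \<and> card S = n - k}
    {S. S \<subseteq> verts G \<and> card S = k \<and>
        zero_forcing_set (G \<restriction> S) (S \<inter> set_neighborhood G (verts G - S))}"
    (is "bij_betw _ ?A ?B")
  \<comment> \<open>Complementation is its own inverse on subsets of \<open>verts G\<close>.\<close>
  proof (rule bij_betw_byWitness[where f' = "\<lambda>S. verts G - S"])
    show "(\<lambda>S. verts G - S) ` ?A \<subseteq> ?B"
    proof (rule image_subsetI)
      fix S assume S: "S \<in> ?A"
      then have "S \<subseteq> verts G" by (simp add: power_dominating_set_def)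
      then have "verts G - (verts G - S) = S" by blast
      \<comment> \<open>The size is \<open>n - (n - k)\<close>, which is \<open>k\<close> because
        \<open>k < n\<close> rules out truncated subtraction.\<close>
      then show "verts G - S \<in> ?B"
        using S \<open>S \<subseteq> verts G\<close> assms(3) iff[of "verts G - S"] by (simp add: card_compl)
    qed
    show "(\<lambda>S. verts G - S) ` ?B \<subseteq> ?A"
      by (auto simp: iff card_compl)
  qed (auto simp: power_dominating_set_def)
  then show ?thesis
    unfolding num_power_dominating_sets_def by (rule bij_betw_same_card)
qed

end
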